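(* Let $\lambda\in\mathbb{C}\setminus\{0\}$ be not a root of unity, let $k\ge 1$ be an integer and write $p=z_1z_2$. Then the map $$(z_1,z_2)\mapsto\left(\frac{\lambda(1+p^k)^{1/k}}{(1+2p^k)^{1/k}}z_1,\ \frac{1}{\lambda(1+p^k)^{1/k}}z_2\right)$$ is conjugate in $\mathfrak{G}_2$ to the polynomial map $$(z_1,z_2)\mapsto\left(\lambda(1+p^k)z_1,\ \lambda^{-1}\left(1+p^k+(2k+1)p^{2k}\right)z_2\right).$$
   Context: $\mathfrak{G}_2$ is the group, under formal composition, of formally invertible formal power series self-maps of $\mathbb{C}^2$ without constant term (pairs of formal power series in $z_1,z_2$ with complex coefficients, zero constant term, and invertible linear part). For a one-variable series $u(t)$ with $u(0)=1$, $u^{1/k}$ denotes the series with constant term $1$ whose $k$-th power is $u$. *)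

theory Defs
  imports
    "HOL-Analysis.Analysis"
    "HOL-Algebra.Group"
    "HOL-Computational_Algebra.Formal_Power_Series"
begin

text \<open>
  The ring of formal power series in two variables is taken to be the iterated ring
  \<open>\<complex>[[z\<^sub>1]][[z\<^sub>2]]\<close>: the outer variable is \<open>z\<^sub>2\<close>, the inner one is \<open>z\<^sub>1\<close>.
\<close>

type_synonym fps2 = "complex fps fps"

definition fps2_nth :: "fps2 \<Rightarrow> nat \<Rightarrow> nat \<Rightarrow> complex" where
  "fps2_nth f i j = fps_nth (fps_nth f j) i"  (* coefficient of z1^i z2^j *)

definition fps2_const :: "complex \<Rightarrow> fps2" where
  "fps2_const c = fps_const (fps_const c)"

definition Z1 :: fps2 where
  "Z1 = fps_const fps_X"

definition Z2 :: fps2 where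
  "Z2 = fps_X"

text \<open>
  Substitution of series without constant term.  A product of \<open>n\<close> such series has no terms of
  total degree below \<open>n\<close>, so the finite sums below contain every contribution to the coefficient
  of \<open>z\<^sub>1\<^sup>i z\<^sub>2\<^sup>j\<close>.  The definitions are meaningful only when the substituted series have
  zero constant term.
\<close>

definition fps2_compose :: "fps2 \<Rightarrow> fps2 \<times> fps2 \<Rightarrow> fps2" where
  "fps2_compose f G = Abs_fps (\<lambda>j. Abs_fps (\<lambda>i.
     \<Sum>(a, b) \<in> {(a, b). a + b \<le> i + j}.
       fps2_nth f a b * fps2_nth (fst G ^ a * snd G ^ b) i j))"

definition fps2_subst :: "complex fps \<Rightarrow> fps2 \<Rightarrow> fps2" where
  "fps2_subst u g = Abs_fps (\<lambda>j. Abs_fps (\<lambda>i.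
     \<Sum>n \<le> i + j. fps_nth u n * fps2_nth (g ^ n) i j))"

definition linear_part :: "fps2 \<times> fps2 \<Rightarrow> complex ^ 2 ^ 2" where
  "linear_part F = vector
     [vector [fps2_nth (fst F) 1 0, fps2_nth (fst F) 0 1],
      vector [fps2_nth (snd F) 1 0, fps2_nth (snd F) 0 1]]"

definition G2 :: "(fps2 \<times> fps2) monoid" where
  "G2 =
    \<lparr>carrier = {F. fps2_nth (fst F) 0 0 = 0 \<and> fps2_nth (snd F) 0 0 = 0 \<and>
                   invertible (linear_part F)},
     monoid.mult = (\<lambda>F G. (fps2_compose (fst F) G, fps2_compose (snd F) G)),
     one = (Z1, Z2)\<rparr>"

definition conjugate_in :: "('a, 'b) monoid_scheme \<Rightarrow> 'a \<Rightarrow> 'a \<Rightarrow> bool" where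
  "conjugate_in G x y \<longleftrightarrow> x \<in> carrier G \<and> y \<in> carrier G \<and>
     (\<exists>g \<in> carrier G. y = g \<otimes>\<^bsub>G\<^esub> x \<otimes>\<^bsub>G\<^esub> inv\<^bsub>G\<^esub> g)"

definition fps_root1 :: "nat \<Rightarrow> complex fps \<Rightarrow> complex fps" where
  "fps_root1 k u = (THE w. fps_nth w 0 = 1 \<and> w ^ k = u)"

lemma fps_root1_unique_exists:
  assumes "k \<ge> 1" and "fps_nth u 0 = (1::complex)"
  shows "\<exists>!w. fps_nth w 0 = 1 \<and> w ^ k = u"
proof -
  obtain m where k: "k = Suc m"
    using assms(1) by (cases k) auto
  let ?r = "\<lambda>(_::nat) (_::complex). 1 :: complex"
  have "fps_nth w 0 = 1 \<and> w ^ k = u \<longleftrightarrow> w = fps_radical ?r k u" for w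
    using radical_unique[of ?r m u w] assms(2) by (auto simp: k simp del: power_Suc)
  then show ?thesis by simp
qed

end

theory Submission
  imports Defs
begin

text \<open>
  Both maps have the form \<open>(u(p\<^sup>k) z\<^sub>1, v(p\<^sup>k) z\<^sub>2)\<close>, so a conjugacy
  \<open>(a(p\<^sup>k) z\<^sub>1, b(p\<^sup>k) z\<^sub>2)\<close> is sought.  In the variable \<open>x = p\<^sup>k\<close> the first map acts
  by \<open>x / (1 + 2x)\<close> and the second one by
  \<open>\<gamma>(x) = x ((1 + x)(1 + x + (2k + 1)x\<^sup>2))\<^sup>k = x + 2k x\<^sup>2 + 4k\<^sup>2 x\<^sup>3 + \<dots>\<close>; the coefficient \<open>2k + 1\<close> is
  exactly what makes the residue of \<open>\<gamma>\<close> vanish.  Hence the Abel equation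
  \<open>1/\<kappa>(\<gamma>) = 1/\<kappa> + 2\<close> has a solution \<open>1/\<kappa> = -1/(k x) + \<xi>(x)\<close>: it becomes an equation
  \<open>\<xi>(\<gamma>) - \<xi> = O(x\<^sup>2)\<close>, which can be solved coefficient by coefficient.  The equation for \<open>a\<close> is
  of the same kind, and \<open>b\<close> is determined by \<open>\<kappa> = x (ab)\<^sup>k\<close>; its equation holds by
  uniqueness of \<open>k\<close>-th roots.
\<close>

subsection \<open>Substitution into series in two variables\<close>

lemma fps2_eqI: "(\<And>i j. fps2_nth f i j = fps2_nth g i j) \<Longrightarrow> f = g"
  by (simp add: fps2_nth_def fps_eq_iff)

lemma fps2_nth_add [simp]: "fps2_nth (f + g) i j = fps2_nth f i j + fps2_nth g i j"
  by (simp add: fps2_nth_def)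

lemma fps2_nth_diff [simp]: "fps2_nth (f - g) i j = fps2_nth f i j - fps2_nth g i j"
  by (simp add: fps2_nth_def)

lemma fps2_nth_zero [simp]: "fps2_nth 0 i j = 0"
  by (simp add: fps2_nth_def)

lemma fps2_nth_one: "fps2_nth 1 i j = (if i = 0 \<and> j = 0 then 1 else 0)"
  by (simp add: fps2_nth_def)

lemma fps2_nth_sum: "fps2_nth (\<Sum>x\<in>A. f x) i j = (\<Sum>x\<in>A. fps2_nth (f x) i j)"
  by (simp add: fps2_nth_def fps_sum_nth)

lemma fps2_nth_mult:
  "fps2_nth (f * g) i j =
     (\<Sum>b=0..j. \<Sum>a=0..i. fps2_nth f a b * fps2_nth g (i - a) (j - b))"
  by (simp add: fps2_nth_def fps_mult_nth fps_sum_nth)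

lemma fps2_nth_const_mult [simp]: "fps2_nth (fps2_const c * f) i j = c * fps2_nth f i j"
  by (simp add: fps2_nth_def fps2_const_def)

lemma fps2_nth_fps_const:
  "fps2_nth (fps_const u) i j = (if j = 0 then fps_nth u i else 0)"
  by (simp add: fps2_nth_def)

lemma fps2_nth_monomial:
  "fps2_nth (Z1 ^ a * Z2 ^ b) i j = (if i = a \<and> j = b then 1 else 0)"
  by (simp add: fps2_nth_def Z1_def Z2_def fps_const_power fps_X_power_iff)

lemma fps2_nth_Z1: "fps2_nth Z1 i j = (if i = 1 \<and> j = 0 then 1 else 0)"
  using fps2_nth_monomial[of 1 0] by simp

lemma fps2_nth_Z2: "fps2_nth Z2 i j = (if i = 0 \<and> j = 1 then 1 else 0)"
  using fps2_nth_monomial[of 0 1] by simp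

lemma fps2_nth_mult_0 [simp]: "fps2_nth (f * g) 0 0 = fps2_nth f 0 0 * fps2_nth g 0 0"
  by (simp add: fps2_nth_mult)

lemma fps2_nth_power_0 [simp]: "fps2_nth (f ^ n) 0 0 = fps2_nth f 0 0 ^ n"
  by (induction n) (simp_all add: fps2_nth_one)

section \<open>Order by total degree, and linear maps that respect it\<close>

definition vanishes_below :: "nat \<Rightarrow> fps2 \<Rightarrow> bool" where
  "vanishes_below n f \<longleftrightarrow> (\<forall>i j. i + j < n \<longrightarrow> fps2_nth f i j = 0)"

lemma vanishes_below_mult:
  assumes "vanishes_below m f" "vanishes_below n g"
  shows "vanishes_below (m + n) (f * g)"
  unfolding vanishes_below_def
proof (intro allI impI)
  fix i j assume ij: "i + j < m + n"
  have "fps2_nth f a b * fps2_nth g (i - a) (j - b) = 0" if "a \<le> i" "b \<le> j" for a b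
  proof (cases "a + b < m")
    case True
    then show ?thesis using assms(1) by (simp add: vanishes_below_def)
  next
    case False
    then have "(i - a) + (j - b) < n" using that ij by linarith
    then show ?thesis using assms(2) by (simp add: vanishes_below_def)
  qed
  then show "fps2_nth (f * g) i j = 0"
    by (auto simp: fps2_nth_mult intro!: sum.neutral)
qed

lemma vanishes_below_mult_left: "vanishes_below n f \<Longrightarrow> vanishes_below n (f * g)"
  using vanishes_below_mult[of n f 0 g] by (simp add: vanishes_below_def)

lemma vanishes_below_power:
  assumes "fps2_nth g 0 0 = 0"
  shows "vanishes_below n (g ^ n)"
proof (induction n)
  case (Suc n)
  have "vanishes_below 1 g" using assms by (simp add: vanishes_below_def)
  from vanishes_below_mult[OF this Suc] show ?case by simp
qed (simp add: vanishes_below_def)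

text \<open>The third clause is continuity for the filtration by total degree. Linearity alone would
  give agreement on polynomials only; with this clause the values on monomials decide
  everything.\<close>

definition fps2_linear :: "(fps2 \<Rightarrow> fps2) \<Rightarrow> bool" where
  "fps2_linear \<Phi> \<longleftrightarrow>
     (\<forall>f g. \<Phi> (f + g) = \<Phi> f + \<Phi> g) \<and> (\<forall>c f. \<Phi> (fps2_const c * f) = fps2_const c * \<Phi> f) \<and>
     (\<forall>n f. vanishes_below n f \<longrightarrow> vanishes_below n (\<Phi> f))"

lemma fps2_linear_sum:
  assumes "fps2_linear \<Phi>"
  shows "\<Phi> (\<Sum>x\<in>A. fps2_const (c x) * f x) = (\<Sum>x\<in>A. fps2_const (c x) * \<Phi> (f x))"
proof -
  have "\<Phi> (fps2_const 0 * 0) = fps2_const 0 * \<Phi> 0"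
    using assms unfolding fps2_linear_def by blast
  then have "\<Phi> 0 = 0" by (simp add: fps2_const_def)
  then show ?thesis
    using assms by (induction A rule: infinite_finite_induct) (auto simp: fps2_linear_def)
qed

lemma finite_total_degree: "finite {(a::nat, b::nat). a + b \<le> n}"
  by (rule finite_subset[of _ "{..n} \<times> {..n}"]) auto

text \<open>Modulo terms of total degree above \<open>n\<close>, every series is a finite combination of monomials.\<close>

lemma fps2_linear_eqI:
  assumes "fps2_linear \<Phi>" "fps2_linear \<Psi>"
    and mono: "\<And>a b. \<Phi> (Z1 ^ a * Z2 ^ b) = \<Psi> (Z1 ^ a * Z2 ^ b)"
  shows "\<Phi> f = \<Psi> f"
proof (rule fps2_eqI)
  fix i j :: nat
  define n where "n = i + j"
  define t where "t = (\<Sum>x\<in>{(a, b). a + b \<le> n}.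
    fps2_const (fps2_nth f (fst x) (snd x)) * (Z1 ^ fst x * Z2 ^ snd x))"
  have t: "\<Phi> t = \<Psi> t"
    unfolding t_def fps2_linear_sum[OF assms(1)] fps2_linear_sum[OF assms(2)] mono ..
  have "fps2_nth t a b = fps2_nth f a b" if "a + b \<le> n" for a b
  proof -
    have "fps2_nth t a b = (\<Sum>x\<in>{(a, b). a + b \<le> n}. if x = (a, b) then fps2_nth f a b else 0)"
      unfolding t_def fps2_nth_sum fps2_nth_const_mult fps2_nth_monomial
      by (rule sum.cong) auto
    also have "\<dots> = fps2_nth f a b"
      using that finite_total_degree[of n] by (simp add: sum.delta)
    finally show ?thesis .
  qed
  then have d: "vanishes_below (Suc n) (f - t)"
    by (simp add: vanishes_below_def)
  have split: "fps2_nth (\<Theta> f) i j = fps2_nth (\<Theta> (f - t)) i j + fps2_nth (\<Theta> t) i j"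
    if "fps2_linear \<Theta>" for \<Theta>
  proof -
    have "\<Theta> ((f - t) + t) = \<Theta> (f - t) + \<Theta> t"
      using that unfolding fps2_linear_def by blast
    then show ?thesis by simp
  qed
  have "fps2_nth (\<Phi> (f - t)) i j = fps2_nth (\<Psi> (f - t)) i j"
    using assms(1,2) d by (simp add: fps2_linear_def vanishes_below_def n_def)
  then show "fps2_nth (\<Phi> f) i j = fps2_nth (\<Psi> f) i j"
    using t by (simp add: split[OF assms(1)] split[OF assms(2)])
qed

section \<open>Composition as a continuous ring homomorphism\<close>

lemma fps2_nth_compose:
  "fps2_nth (fps2_compose f G) i j =
     (\<Sum>(a, b) \<in> {(a, b). a + b \<le> i + j}. fps2_nth f a b * fps2_nth (fst G ^ a * snd G ^ b) i j)"
  unfolding fps2_compose_def by (subst fps2_nth_def) simp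

lemma fps2_linear_compose: "fps2_linear (\<lambda>f. fps2_compose f G)"
  unfolding fps2_linear_def
proof (intro conjI allI impI)
  show "fps2_compose (f + g) G = fps2_compose f G + fps2_compose g G" for f g
    by (rule fps2_eqI) (simp add: fps2_nth_compose sum.distrib case_prod_beta distrib_right)
  show "fps2_compose (fps2_const c * f) G = fps2_const c * fps2_compose f G" for c f
    by (rule fps2_eqI) (simp add: fps2_nth_compose sum_distrib_left case_prod_beta mult.assoc)
  show "vanishes_below n f \<Longrightarrow> vanishes_below n (fps2_compose f G)" for n f
    unfolding vanishes_below_def fps2_nth_compose by (auto intro!: sum.neutral)
qed

lemma fps2_linear_mult:
  "fps2_linear \<Phi> \<Longrightarrow> fps2_linear (\<lambda>f. \<Phi> f * h)"
  "fps2_linear \<Phi> \<Longrightarrow> fps2_linear (\<lambda>f. h * \<Phi> f)"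
  unfolding fps2_linear_def
  using vanishes_below_mult_left vanishes_below_mult_left[of _ _ h, unfolded mult.commute[of _ h]]
  by (auto simp: distrib_left distrib_right mult.assoc mult.left_commute)

lemma fps2_linear_comp:
  "fps2_linear \<Phi> \<Longrightarrow> fps2_linear \<Psi> \<Longrightarrow> fps2_linear (\<lambda>f. \<Phi> (\<Psi> f))"
  unfolding fps2_linear_def by simp

lemma fps2_linear_id: "fps2_linear (\<lambda>f. f)"
  by (simp add: fps2_linear_def)

definition no_const :: "fps2 \<times> fps2 \<Rightarrow> bool" where
  "no_const G \<longleftrightarrow> fps2_nth (fst G) 0 0 = 0 \<and> fps2_nth (snd G) 0 0 = 0"

lemma no_const_Pair: "no_const (f, g) \<longleftrightarrow> fps2_nth f 0 0 = 0 \<and> fps2_nth g 0 0 = 0"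
  by (simp add: no_const_def)

lemma fps2_compose_monomial:
  assumes "no_const G"
  shows "fps2_compose (Z1 ^ a * Z2 ^ b) G = fst G ^ a * snd G ^ b"
proof (rule fps2_eqI)
  fix i j
  have "fps2_nth (fps2_compose (Z1 ^ a * Z2 ^ b) G) i j =
    (\<Sum>x\<in>{(a, b). a + b \<le> i + j}. if x = (a, b) then fps2_nth (fst G ^ a * snd G ^ b) i j else 0)"
    unfolding fps2_nth_compose fps2_nth_monomial by (rule sum.cong) (auto split: if_splits)
  also have "\<dots> = (if a + b \<le> i + j then fps2_nth (fst G ^ a * snd G ^ b) i j else 0)"
    using finite_total_degree[of "i + j"] by (simp add: sum.delta)
  \<comment> \<open>For a + b > i + j the truncated sum omits the monomial, but then the coefficient
    is 0 anyway, because the product has order at least a + b.\<close>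
  also have "\<dots> = fps2_nth (fst G ^ a * snd G ^ b) i j"
    using vanishes_below_mult[OF vanishes_below_power vanishes_below_power, of "fst G" "snd G" a b] assms
    by (simp add: vanishes_below_def no_const_def)
  finally show "fps2_nth (fps2_compose (Z1 ^ a * Z2 ^ b) G) i j = fps2_nth (fst G ^ a * snd G ^ b) i j" .
qed

lemma fps2_compose_Z1: "no_const G \<Longrightarrow> fps2_compose Z1 G = fst G"
  using fps2_compose_monomial[of G 1 0] by simp

lemma fps2_compose_Z2: "no_const G \<Longrightarrow> fps2_compose Z2 G = snd G"
  using fps2_compose_monomial[of G 0 1] by simp

lemma fps2_compose_1: "no_const G \<Longrightarrow> fps2_compose 1 G = 1"
  using fps2_compose_monomial[of G 0 0] by simp

lemma fps2_compose_0: "fps2_compose 0 G = 0"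
  by (rule fps2_eqI) (simp add: fps2_nth_compose)

lemma fps2_compose_add: "fps2_compose (f + g) G = fps2_compose f G + fps2_compose g G"
  using fps2_linear_compose by (simp add: fps2_linear_def)

text \<open>Both sides are linear and continuous in each factor separately, so it suffices to
  compare them on monomials, first in \<open>f\<close> and then in \<open>g\<close>.\<close>

lemma fps2_compose_mult:
  assumes G: "no_const G"
  shows "fps2_compose (f * g) G = fps2_compose f G * fps2_compose g G"
proof (rule fps2_linear_eqI[of "\<lambda>f. fps2_compose (f * g) G" "\<lambda>f. fps2_compose f G * fps2_compose g G"])
  fix a b
  let ?h = "Z1 ^ a * Z2 ^ b"
  show "fps2_compose (?h * g) G = fps2_compose ?h G * fps2_compose g G"
  proof (rule fps2_linear_eqI[of "\<lambda>g. fps2_compose (?h * g) G" "\<lambda>g. fps2_compose ?h G * fps2_compose g G"])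
    fix c d
    have "?h * (Z1 ^ c * Z2 ^ d) = Z1 ^ (a + c) * Z2 ^ (b + d)"
      by (simp add: power_add ac_simps)
    then show "fps2_compose (?h * (Z1 ^ c * Z2 ^ d)) G = fps2_compose ?h G * fps2_compose (Z1 ^ c * Z2 ^ d) G"
      by (simp only: fps2_compose_monomial[OF G]) (simp add: power_add ac_simps)
  qed (intro fps2_linear_comp[OF fps2_linear_compose] fps2_linear_mult fps2_linear_id fps2_linear_compose)+
qed (intro fps2_linear_comp[OF fps2_linear_compose] fps2_linear_mult fps2_linear_id fps2_linear_compose)+

lemma fps2_compose_power:
  "no_const G \<Longrightarrow> fps2_compose (f ^ n) G = fps2_compose f G ^ n"
  by (induction n) (simp_all add: fps2_compose_1 fps2_compose_mult)

lemma fps2_nth_compose_0: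
  "fps2_nth (fps2_compose f G) 0 0 = fps2_nth f 0 0"
proof -
  have "{(a::nat, b::nat). a + b \<le> 0 + 0} = {(0, 0)}" by auto
  then show ?thesis by (simp only: fps2_nth_compose) (simp add: fps2_nth_one)
qed

text \<open>Both sides are linear and continuous in \<open>f\<close>; on monomials the claim is
  multiplicativity of composition with \<open>H\<close>.\<close>

lemma fps2_compose_assoc:
  assumes "no_const G" "no_const H"
  shows "fps2_compose (fps2_compose f G) H = fps2_compose f (fps2_compose (fst G) H, fps2_compose (snd G) H)"
proof (rule fps2_linear_eqI[of "\<lambda>f. fps2_compose (fps2_compose f G) H"
      "\<lambda>f. fps2_compose f (fps2_compose (fst G) H, fps2_compose (snd G) H)"])
  have "no_const (fps2_compose (fst G) H, fps2_compose (snd G) H)"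
    using assms(1) by (simp add: no_const_def fps2_nth_compose_0)
  then show "fps2_compose (fps2_compose (Z1 ^ a * Z2 ^ b) G) H =
    fps2_compose (Z1 ^ a * Z2 ^ b) (fps2_compose (fst G) H, fps2_compose (snd G) H)" for a b
    using assms by (simp add: fps2_compose_mult fps2_compose_power fps2_compose_Z1 fps2_compose_Z2)
qed (intro fps2_linear_comp[OF fps2_linear_compose] fps2_linear_compose)+

lemma fps2_compose_id: "fps2_compose f (Z1, Z2) = f"
proof (rule fps2_linear_eqI[of "\<lambda>f. fps2_compose f (Z1, Z2)" "\<lambda>f. f"])
  show "fps2_compose (Z1 ^ a * Z2 ^ b) (Z1, Z2) = Z1 ^ a * Z2 ^ b" for a b
    by (subst fps2_compose_monomial) (simp_all add: no_const_def fps2_nth_Z1 fps2_nth_Z2)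
qed (intro fps2_linear_compose fps2_linear_id)+

text \<open>Regarded as a series in z1 alone, \<open>u\<close> sees only the first component of the
  inner map. Through this bridge the rules for substitution are inherited from those for
  composition.\<close>

lemma fps2_subst_eq_compose: "fps2_subst u g = fps2_compose (fps_const u) (g, 0)"
proof (rule fps2_eqI)
  fix i j
  have "fps2_nth (fps2_compose (fps_const u) (g, 0)) i j =
    (\<Sum>(a, b)\<in>(\<lambda>n. (n, 0)) ` {..i + j}. fps2_nth (fps_const u) a b * fps2_nth (g ^ a * 0 ^ b) i j)"
    unfolding fps2_nth_compose fst_conv snd_conv
    by (rule sum.mono_neutral_right[OF finite_total_degree]) (auto simp: fps2_nth_fps_const image_iff)
  also have "\<dots> = (\<Sum>n\<le>i + j. fps_nth u n * fps2_nth (g ^ n) i j)"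
    by (subst sum.reindex) (auto simp: inj_on_def fps2_nth_fps_const)
  finally show "fps2_nth (fps2_subst u g) i j = fps2_nth (fps2_compose (fps_const u) (g, 0)) i j"
    unfolding fps2_subst_def by (subst fps2_nth_def) simp
qed

context
  fixes g :: fps2
  assumes g: "fps2_nth g 0 0 = 0"
begin

lemma no_const_pair_0: "no_const (g, 0)"
  using g by (simp add: no_const_def)

lemma fps2_subst_add: "fps2_subst (u + v) g = fps2_subst u g + fps2_subst v g"
  by (simp add: fps2_subst_eq_compose fps2_compose_add flip: fps_const_add)

lemma fps2_subst_mult: "fps2_subst (u * v) g = fps2_subst u g * fps2_subst v g"
  by (simp add: fps2_subst_eq_compose fps2_compose_mult[OF no_const_pair_0] flip: fps_const_mult)

lemma fps2_subst_1: "fps2_subst 1 g = 1"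
  by (simp add: fps2_subst_eq_compose fps2_compose_1[OF no_const_pair_0])

lemma fps2_subst_power: "fps2_subst (u ^ n) g = fps2_subst u g ^ n"
  by (induction n) (simp_all add: fps2_subst_1 fps2_subst_mult)

lemma fps2_subst_X: "fps2_subst fps_X g = g"
  using fps2_compose_Z1[OF no_const_pair_0] by (simp add: fps2_subst_eq_compose Z1_def)

lemma fps2_subst_const: "fps2_subst (fps_const c) g = fps2_const c"
proof -
  have "fps2_compose (fps2_const c * 1) (g, 0) = fps2_const c * fps2_compose 1 (g, 0)"
    using fps2_linear_compose unfolding fps2_linear_def by blast
  then show ?thesis
    by (simp add: fps2_subst_eq_compose fps2_compose_1[OF no_const_pair_0] fps2_const_def)
qed

lemma fps2_subst_compose:
  assumes "fps_nth v 0 = 0"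
  shows "fps2_subst (u oo v) g = fps2_subst u (fps2_subst v g)"
proof -
  \<comment> \<open>One-variable composition is itself a substitution of a series in z1 alone, so
    that the claim becomes associativity of \<open>fps2_compose\<close>.\<close>
  have "fps_const (u oo v) = fps2_subst u (fps_const v)"
  proof (rule fps2_eqI)
    fix i j
    have "fps2_nth (fps_const v ^ n) i j = (if j = 0 then fps_nth (v ^ n) i else 0)" for n
      by (simp add: fps_const_power fps2_nth_fps_const)
    then show "fps2_nth (fps_const (u oo v)) i j = fps2_nth (fps2_subst u (fps_const v)) i j"
      unfolding fps2_subst_def
      by (subst (2) fps2_nth_def) (simp add: fps2_nth_fps_const fps_compose_nth atLeast0AtMost)
  qed
  then show ?thesis
    using assms by (simp add: fps2_subst_eq_compose fps2_compose_assoc g no_const_Pair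
        fps2_nth_fps_const fps2_compose_0)
qed

lemma fps2_compose_subst:
  "no_const G \<Longrightarrow> fps2_compose (fps2_subst u g) G = fps2_subst u (fps2_compose g G)"
  by (simp add: fps2_subst_eq_compose fps2_compose_assoc no_const_pair_0 fps2_compose_0)

end

lemma fps2_nth_subst_0: "fps2_nth (fps2_subst u g) 0 0 = fps_nth u 0"
  by (simp add: fps2_subst_eq_compose fps2_nth_compose_0 fps2_nth_fps_const)

subsection \<open>The conjugacy in one variable\<close>

lemma fps_nth_2_mult:
  fixes f g :: "'a::comm_semiring_1 fps"
  shows "fps_nth (f * g) 2 = fps_nth f 0 * fps_nth g 2 + fps_nth f 1 * fps_nth g 1 + fps_nth f 2 * fps_nth g 0"
  by (simp add: fps_mult_nth numeral_2_eq_2)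

lemma fps_power_second_eq:
  fixes w :: "complex fps"
  assumes "fps_nth w 0 = 1"
  shows "fps_nth (w ^ n) 2 = of_nat n * fps_nth w 2 + of_nat n * (of_nat n - 1) / 2 * fps_nth w 1 ^ 2"
proof (induction n)
  case (Suc n)
  have "fps_nth (w ^ Suc n) 2 = fps_nth (w ^ n) 2 + fps_nth w 1 * (of_nat n * fps_nth w 1) + fps_nth w 2"
    using assms by (simp only: power_Suc fps_nth_2_mult fps_power_first_eq[OF assms] fps_power_zeroth_eq_one[OF assms]) simp
  then show ?case
    unfolding Suc by (simp add: field_simps power2_eq_square)
qed simp

lemma fps_X_mult_power_nth:
  fixes s :: "'a::comm_ring_1 fps"
  shows "fps_nth ((fps_X * s) ^ i) n = (if n < i then 0 else fps_nth (s ^ i) (n - i))"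
  by (simp add: power_mult_distrib fps_X_power_mult_nth)

text \<open>Forward substitution in a triangular linear system with diagonal entries n c. Row n will
  be the coefficient of x^(n+1) in a functional equation, hence \<open>r (Suc n)\<close>; the value
  \<open>v\<close> at 0 is a free parameter.\<close>

fun cohomological_coeff :: "complex \<Rightarrow> complex \<Rightarrow> (nat \<Rightarrow> complex) \<Rightarrow> (nat \<Rightarrow> nat \<Rightarrow> complex) \<Rightarrow> nat \<Rightarrow> complex" where
  "cohomological_coeff c v r M n =
     (if n = 0 then v
      else (r (Suc n) - (\<Sum>i<n. cohomological_coeff c v r M i * M n i)) / (of_nat n * c))"

declare cohomological_coeff.simps [simp del]

text \<open>The term x^n enters the difference of \<open>a oo (fps_X * s)\<close> and
  \<open>T * a\<close> as x^n (s^n - T) = n s_1 x^(n+1) + ..., because T = 1 + O(x^2). So the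
  coefficient of x^(n+1) determines a_n for n > 0, while orders 0 and 1 hold for every a_0 because R
  = O(x^2).\<close>

lemma cohomological_equation:
  fixes s T R :: "complex fps"
  assumes s: "fps_nth s 0 = 1" "fps_nth s 1 \<noteq> 0"
    and T: "fps_nth T 0 = 1" "fps_nth T 1 = 0"
    and R: "fps_nth R 0 = 0" "fps_nth R 1 = 0"
  obtains a where "fps_nth a 0 = v" "a oo (fps_X * s) = T * a + R"
proof
  \<comment> \<open>This is the factor with which a_i contributes to the coefficient of
    x^(n+1).\<close>
  define M where "M n i = fps_nth (s ^ i) (Suc n - i) - fps_nth T (Suc n - i)" for n i
  define a where "a = Abs_fps (cohomological_coeff (fps_nth s 1) v (fps_nth R) M)"
  show a0: "fps_nth a 0 = v"
    by (simp add: a_def cohomological_coeff.simps)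
  have rec: "of_nat n * fps_nth s 1 * fps_nth a n + (\<Sum>i<n. fps_nth a i * M n i) = fps_nth R (Suc n)"
    if "n > 0" for n
    using s(2) that by (simp add: a_def cohomological_coeff.simps[of _ _ _ _ n])
  show "a oo (fps_X * s) = T * a + R"
  proof (rule fps_ext)
    fix m
    show "fps_nth (a oo (fps_X * s)) m = fps_nth (T * a + R) m"
    proof (cases m)
      case 0
      then show ?thesis using T R by simp
    next
      case (Suc n)
      have M_self: "M n n = of_nat n * fps_nth s 1"
        using fps_power_first_eq[OF s(1), of n] T(2) by (simp add: M_def)
      have "fps_nth (a oo (fps_X * s)) (Suc n) = (\<Sum>i\<le>Suc n. fps_nth a i * fps_nth (s ^ i) (Suc n - i))"
        by (simp add: fps_compose_nth fps_X_mult_power_nth atLeast0AtMost del: sum.atMost_Suc)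
      moreover have "fps_nth (T * a) (Suc n) = (\<Sum>i\<le>Suc n. fps_nth a i * fps_nth T (Suc n - i))"
        by (subst mult.commute) (simp add: fps_mult_nth atLeast0AtMost del: sum.atMost_Suc)
      ultimately have "fps_nth (a oo (fps_X * s)) (Suc n) - fps_nth (T * a) (Suc n) =
          (\<Sum>i\<le>Suc n. fps_nth a i * M n i)"
        by (simp only: M_def right_diff_distrib sum_subtractf)
      \<comment> \<open>The term i = n + 1 drops out because s^(n+1) and \<open>T\<close> have the
        same constant term 1.\<close>
      also have "\<dots> = (\<Sum>i<n. fps_nth a i * M n i) + fps_nth a n * M n n"
        using T(1) s(1) by (simp add: lessThan_Suc_atMost[symmetric] M_def[of n "Suc n"] fps_power_zeroth)
      also have "\<dots> = fps_nth R (Suc n)"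
        using rec[of n] R(2) M_self by (cases "n = 0") (simp_all add: mult.commute add.commute)
      finally show ?thesis by (simp add: Suc algebra_simps)
    qed
  qed
qed

text \<open>Multiplied by x, the conclusion reads \<kappa>(\<gamma>) (1 + 2 \<kappa>) = \<kappa> for
  \<kappa> = x m and \<gamma> = x s. This is the Abel equation with its poles cleared;
  \<open>m\<close> is found through its reciprocal.\<close>

lemma parabolic_linearization:
  fixes s :: "complex fps" and k :: nat
  assumes k: "k \<ge> 1" and s: "fps_nth s 0 = 1" "fps_nth s 1 = 2 * of_nat k" "fps_nth s 2 = 4 * of_nat k ^ 2"
  obtains m where "fps_nth m 0 = - of_nat k"
    "s * (m oo (fps_X * s)) * (1 + 2 * fps_X * m) = m"
proof -
  \<comment> \<open>Inserting 1/\<kappa> = c/x + \<xi> into 1/\<kappa>(\<gamma>) = 1/\<kappa> + 2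
    leaves \<xi>(\<gamma>) - \<xi> = \<open>R\<close>. The value c = -1/k removes the constant term
    of \<open>R\<close>.\<close>
  define c :: complex where "c = - 1 / of_nat k"
  define R where "R = 2 + fps_const c * fps_shift 1 (1 - inverse s)"
  have s_inv: "inverse s * s = 1"
    using s(1) by (intro inverse_mult_eq_1) simp
  have i1: "fps_nth (inverse s) 1 = - 2 * of_nat k"
    using arg_cong[OF s_inv, of "\<lambda>f. fps_nth f 1"] s by (simp add: fps_mult_nth_1 add_eq_0_iff)
  \<comment> \<open>The vanishing residue: \<open>fps_nth s 2\<close> is the square of
    \<open>fps_nth s 1\<close>. This removes the linear term of \<open>R\<close>.\<close>
  have i2: "fps_nth (inverse s) 2 = 0"
    using arg_cong[OF s_inv, of "\<lambda>f. fps_nth f 2"] s i1 by (simp add: fps_nth_2_mult power2_eq_square)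
  have R0: "fps_nth R 0 = 0" and R1: "fps_nth R 1 = 0"
    using i1 i2 k by (simp_all add: R_def c_def fps_numeral_nth flip: numeral_2_eq_2)
  obtain \<xi> where \<xi>: "\<xi> oo (fps_X * s) = 1 * \<xi> + R"
    by (rule cohomological_equation[of s 1 R 0]) (use s k R0 R1 in auto)
  \<comment> \<open>\<open>N\<close> plays the role of 1/m = x/\<kappa>, for which the Abel equation
    becomes N(\<gamma>) = s (N + 2 x).\<close>
  define N where "N = fps_const c + fps_X * \<xi>"
  have "fps_X * fps_shift 1 (1 - inverse s) = 1 - inverse s"
    using s by (intro fps_ext) (auto simp: not_less_eq split: nat.splits)
  then have "fps_X * s * R = 2 * fps_X * s + fps_const c * (s * (1 - inverse s))"
    unfolding R_def by (simp add: distrib_left ac_simps)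
  then have XR: "fps_X * s * R = 2 * fps_X * s + fps_const c * (s - 1)"
    using s_inv by (simp add: right_diff_distrib mult.commute[of s])
  have c: "c \<noteq> 0" using k by (simp add: c_def)
  have N0: "fps_nth N 0 \<noteq> 0" using c by (simp add: N_def)
  have X0: "fps_nth (fps_X * s) 0 = 0" by simp
  define m where "m = inverse N"
  have mN: "m * N = 1" unfolding m_def using N0 by (rule inverse_mult_eq_1)
  have "N oo (fps_X * s) = fps_const c + (fps_X oo (fps_X * s)) * (\<xi> oo (fps_X * s))"
    unfolding N_def by (simp only: fps_compose_add_distrib fps_const_compose fps_compose_mult_distrib[OF X0])
  also have "fps_X oo (fps_X * s) = fps_X * s"
    by (rule fps_X_fps_compose_startby0) simp
  also have "fps_const c + fps_X * s * (\<xi> oo (fps_X * s)) = fps_const c + fps_X * s * \<xi> + fps_X * s * R"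
    by (simp add: \<xi> distrib_left)
  also have "\<dots> = s * (N + 2 * fps_X)"
    unfolding XR N_def by (simp add: algebra_simps)
  finally have No: "N oo (fps_X * s) = s * (N + 2 * fps_X)" .
  have "(m oo (fps_X * s)) * (N oo (fps_X * s)) = 1"
    by (simp add: mN flip: fps_compose_mult_distrib[OF X0])
  then have mo: "(m oo (fps_X * s)) * (s * (N + 2 * fps_X)) = 1"
    by (simp only: No)
  have "s * (m oo (fps_X * s)) * (1 + 2 * fps_X * m) = s * (m oo (fps_X * s)) * (m * N + 2 * fps_X * m)"
    by (simp only: mN)
  also have "\<dots> = (m oo (fps_X * s)) * (s * (N + 2 * fps_X)) * m"
    by (simp only: algebra_simps)
  finally have "s * (m oo (fps_X * s)) * (1 + 2 * fps_X * m) = m"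
    by (simp only: mo mult_1)
  moreover have "fps_nth m 0 = - of_nat k"
    by (simp add: m_def N_def c_def)
  ultimately show ?thesis by (rule that[rotated])
qed

text \<open>The two equations are the components of the conjugacy relation, divided by \<lambda> and
  1/\<lambda>. Here \<gamma> is the action of the polynomial map on x = p^k, and
  \<open>fps_X * (a * b) ^ k\<close> is the action of the conjugating map.\<close>

lemma one_variable_conjugacy:
  fixes k :: nat and r\<^sub>1 r\<^sub>2 :: "complex fps"
  defines "Q \<equiv> 1 + fps_X + of_nat (2 * k + 1) * fps_X ^ 2"
  defines "\<gamma> \<equiv> fps_X * ((1 + fps_X) * Q) ^ k"
  assumes k: "k \<ge> 1"
    and r\<^sub>1: "fps_nth r\<^sub>1 0 = 1" "r\<^sub>1 ^ k = 1 + fps_X"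
    and r\<^sub>2: "fps_nth r\<^sub>2 0 = 1" "r\<^sub>2 ^ k = 1 + 2 * fps_X"
  obtains a b where "fps_nth a 0 \<noteq> 0" "fps_nth b 0 \<noteq> 0"
    "(a oo \<gamma>) * (1 + fps_X) = ((r\<^sub>1 / r\<^sub>2) oo (fps_X * (a * b) ^ k)) * a"
    "(b oo \<gamma>) * Q = ((1 / r\<^sub>1) oo (fps_X * (a * b) ^ k)) * b"
proof -
  define q where "q = (1 + fps_X) * Q"
  define s where "s = q ^ k"
  have Q: "fps_nth Q 0 = 1" "fps_nth Q 1 = 1" "fps_nth Q 2 = 2 * of_nat k + 1"
    by (simp_all add: Q_def fps_X_power_iff flip: fps_of_nat)
  have q: "fps_nth q 0 = 1" "fps_nth q 1 = 2" "fps_nth q 2 = 2 * of_nat k + 2"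
    using Q by (simp_all add: q_def fps_mult_nth_1 fps_nth_2_mult)
  \<comment> \<open>The second-order coefficient is k (2k + 2) + 2k (k - 1) = 4 k^2.\<close>
  have s: "fps_nth s 0 = 1" "fps_nth s 1 = 2 * of_nat k" "fps_nth s 2 = 4 * of_nat k ^ 2"
    using q fps_power_first_eq[OF q(1), of k] fps_power_second_eq[OF q(1), of k]
    by (simp_all add: s_def fps_power_zeroth field_simps power2_eq_square)
  have \<gamma>: "\<gamma> = fps_X * s" by (simp add: \<gamma>_def s_def q_def)
  have \<gamma>0: "fps_nth \<gamma> 0 = 0" by (simp add: \<gamma>)
  obtain m where m: "fps_nth m 0 = - of_nat k" "s * (m oo \<gamma>) * (1 + 2 * fps_X * m) = m"
    using parabolic_linearization[OF k s] unfolding \<gamma> by blast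
  define \<kappa> where "\<kappa> = fps_X * m"
  have \<kappa>0: "fps_nth \<kappa> 0 = 0" by (simp add: \<kappa>_def)
  have \<kappa>1: "fps_nth \<kappa> 1 = - of_nat k" using m by (simp add: \<kappa>_def)

  have r\<^sub>11: "of_nat k * fps_nth r\<^sub>1 1 = 1"
    using fps_power_first_eq[OF r\<^sub>1(1), of k] r\<^sub>1(2) by simp
  have r\<^sub>21: "of_nat k * fps_nth r\<^sub>2 1 = 2"
    using fps_power_first_eq[OF r\<^sub>2(1), of k] r\<^sub>2(2) by (simp add: fps_numeral_nth)
  have div: "r\<^sub>1 / r\<^sub>2 * r\<^sub>2 = r\<^sub>1" "1 / r\<^sub>1 * r\<^sub>1 = 1"
    using r\<^sub>1(1) r\<^sub>2(1) by (simp_all add: fps_divide_unit mult.assoc inverse_mult_eq_1)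
  have A0: "fps_nth (r\<^sub>1 / r\<^sub>2) 0 = 1"
    using arg_cong[OF div(1), of "\<lambda>f. fps_nth f 0"] r\<^sub>1(1) r\<^sub>2(1) by simp
  have "fps_nth (r\<^sub>1 / r\<^sub>2) 1 + fps_nth r\<^sub>2 1 = fps_nth r\<^sub>1 1"
    using arg_cong[OF div(1), of "\<lambda>f. fps_nth f 1", unfolded fps_mult_nth_1] r\<^sub>2(1) A0 by (simp add: add.commute)
  then have "of_nat k * fps_nth (r\<^sub>1 / r\<^sub>2) 1 = of_nat k * fps_nth r\<^sub>1 1 - of_nat k * fps_nth r\<^sub>2 1"
    by (simp add: algebra_simps flip: distrib_left)
  then have A1: "of_nat k * fps_nth (r\<^sub>1 / r\<^sub>2) 1 = - 1"
    unfolding r\<^sub>11 r\<^sub>21 by simp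

  define A where "A = (r\<^sub>1 / r\<^sub>2) oo \<kappa>"
  have "fps_nth A 1 = fps_nth (r\<^sub>1 / r\<^sub>2) 1 * fps_nth \<kappa> 1"
    by (simp add: A_def fps_compose_nth)
  then have A: "fps_nth A 0 = 1" "fps_nth A 1 = 1"
    using A0 A1 \<kappa>1 by (simp_all add: A_def algebra_simps)
  define L where "L = inverse (1 + fps_X :: complex fps)"
  have L: "L * (1 + fps_X) = 1"
    unfolding L_def by (rule inverse_mult_eq_1) simp
  have L1: "fps_nth L 0 = 1" "fps_nth L 1 = - 1"
    using arg_cong[OF L, of "\<lambda>f. fps_nth f 1"] by (simp_all add: L_def fps_mult_nth_1 add_eq_0_iff)
  \<comment> \<open>The linear coefficient of \<open>A\<close> is (-1/k)(-k) = 1 and that of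
    \<open>L\<close> is -1, so \<open>A * L\<close> has no linear term, as
    \<open>cohomological_equation\<close> demands.\<close>
  obtain a where a: "fps_nth a 0 = 1" "a oo \<gamma> = A * L * a + 0"
    unfolding \<gamma> by (rule cohomological_equation[of s "A * L" 0 1])
      (use s A L1 k in \<open>auto simp: fps_mult_nth_1\<close>)
  have "(a oo \<gamma>) * (1 + fps_X) = A * a * (L * (1 + fps_X))"
    unfolding a(2) by (simp add: ac_simps)
  then have aeq: "(a oo \<gamma>) * (1 + fps_X) = A * a"
    by (simp only: L mult_1_right)

  \<comment> \<open>A k-th root \<open>w\<close> of \<open>m\<close> is wanted, but \<open>m\<close>
    has constant term -k. The normalized root of m/(-k) is therefore scaled by some k-th root of
    -k.\<close>
  obtain c :: complex where c: "c ^ k = - of_nat k"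
  proof -
    have "card {z :: complex. z ^ k = - of_nat k} = k"
      using k by (intro card_nth_roots) auto
    then have "{z :: complex. z ^ k = - of_nat k} \<noteq> {}"
      using k by (metis card.empty not_one_le_zero)
    then show ?thesis using that by blast
  qed
  have c0: "c \<noteq> 0" using c k by (auto simp: power_0_left)
  define w where "w = fps_const c * fps_root1 k (m / fps_const (- of_nat k))"
  have m_div: "m / fps_const (- of_nat k) = fps_const (- 1 / of_nat k) * m"
    using k by (simp add: fps_divide_unit fps_const_inverse mult.commute inverse_eq_divide)
  have "\<exists>!w. fps_nth w 0 = 1 \<and> w ^ k = m / fps_const (- of_nat k)"
    using k m(1) by (intro fps_root1_unique_exists) (simp_all add: m_div)
  from theI'[OF this] have root: "fps_nth (fps_root1 k (m / fps_const (- of_nat k))) 0 = 1"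
    "fps_root1 k (m / fps_const (- of_nat k)) ^ k = m / fps_const (- of_nat k)"
    unfolding fps_root1_def by auto
  have w: "fps_nth w 0 = c" "w ^ k = m"
    using root k c by (simp_all add: w_def power_mult_distrib m_div)
  \<comment> \<open>With a b = w the series x (a b)^k is x m = \<kappa>, as was presupposed in the
    definition of \<open>A\<close>.\<close>
  define b where "b = w * inverse a"
  have ab: "a * b = w"
    using inverse_mult_eq_1[of a] a(1) by (simp add: b_def mult.left_commute[of a] mult.commute[of a])
  have b0: "fps_nth b 0 = c" using a w by (simp add: b_def)
  define B where "B = (1 / r\<^sub>1) oo \<kappa>"
  define r where "r = r\<^sub>2 oo \<kappa>"
  have "A * r = r\<^sub>1 oo \<kappa>"
    unfolding A_def r_def by (simp add: div(1) flip: fps_compose_mult_distrib[OF \<kappa>0])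
  moreover have "B * (r\<^sub>1 oo \<kappa>) = 1"
    unfolding B_def by (simp add: div(2) flip: fps_compose_mult_distrib[OF \<kappa>0])
  ultimately have "B * (A * r) = 1" by simp
  then have ABr: "A * B * r = 1" by (simp only: ac_simps)
  have rk: "r ^ k = 1 + 2 * \<kappa>"
    unfolding r_def fps_compose_power[OF \<kappa>0] r\<^sub>2(2)
    by (simp add: fps_compose_add_distrib fps_compose_mult_distrib[OF \<kappa>0]
        fps_X_fps_compose_startby0[OF \<kappa>0] fps_numeral_fps_const)
  \<comment> \<open>Since q^k = s, w^k = m and r^k = 1 + 2 \<kappa>, this is the equation for
    \<open>m\<close>. Both bases have constant term \<open>c\<close>, which is nonzero, so the k-th
    powers can be removed.\<close>
  have "(q * (w oo \<gamma>) * r) ^ k = w ^ k"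
    unfolding power_mult_distrib fps_compose_power[OF \<gamma>0] rk w(2) using m(2)
    by (simp add: s_def \<kappa>_def mult.assoc)
  then have weq: "q * (w oo \<gamma>) * r = w"
    by (rule fps_power_eqD) (use q w r\<^sub>2 c0 k in \<open>simp_all add: r_def\<close>)
  \<comment> \<open>The product of the two desired equations follows from \<open>weq\<close>, as A B
    = 1/r. Cancelling the known equation for \<open>a\<close> leaves the one for
    \<open>b\<close>.\<close>
  have "(a oo \<gamma>) * (1 + fps_X) * ((b oo \<gamma>) * Q) = q * (w oo \<gamma>)"
    unfolding q_def ab[symmetric] fps_compose_mult_distrib[OF \<gamma>0] by (simp add: ac_simps)
  also have "\<dots> = q * (w oo \<gamma>) * (A * B * r)"
    by (simp only: ABr mult_1_right)
  also have "\<dots> = A * B * (q * (w oo \<gamma>) * r)"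
    by (simp only: ac_simps)
  also have "\<dots> = A * B * (a * b)"
    by (simp only: weq ab)
  also have "\<dots> = A * a * (B * b)"
    by (simp only: ac_simps)
  finally have "(a oo \<gamma>) * (1 + fps_X) * ((b oo \<gamma>) * Q) = (a oo \<gamma>) * (1 + fps_X) * (B * b)"
    by (simp only: aeq)
  moreover have "(a oo \<gamma>) * (1 + fps_X) \<noteq> 0"
    using a(1) by (auto dest!: arg_cong[of _ _ "\<lambda>f. fps_nth f 0"])
  ultimately have beq: "(b oo \<gamma>) * Q = B * b"
    by (simp only: mult_cancel_left) simp
  show ?thesis
    by (rule that[of a b]) (use a b0 c0 aeq beq in \<open>simp_all add: ab w(2) flip: \<kappa>_def A_def B_def\<close>)
qed

subsection \<open>The group and its diagonal maps\<close>

lemma G2_mult: "x \<otimes>\<^bsub>G2\<^esub> y = (fps2_compose (fst x) y, fps2_compose (snd x) y)"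
  by (simp add: G2_def)

lemma G2_one: "\<one>\<^bsub>G2\<^esub> = (Z1, Z2)"
  by (simp add: G2_def)

lemma G2_no_const: "x \<in> carrier G2 \<Longrightarrow> no_const x"
  by (simp add: G2_def no_const_def)

lemma G2_assoc:
  "no_const y \<Longrightarrow> no_const z \<Longrightarrow> x \<otimes>\<^bsub>G2\<^esub> y \<otimes>\<^bsub>G2\<^esub> z = x \<otimes>\<^bsub>G2\<^esub> (y \<otimes>\<^bsub>G2\<^esub> z)"
  by (simp add: G2_mult fps2_compose_assoc)

lemma G2_r_one: "x \<otimes>\<^bsub>G2\<^esub> \<one>\<^bsub>G2\<^esub> = x"
  by (simp add: G2_mult G2_one fps2_compose_id)

lemma G2_l_one: "no_const x \<Longrightarrow> \<one>\<^bsub>G2\<^esub> \<otimes>\<^bsub>G2\<^esub> x = x"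
  by (simp add: G2_mult G2_one fps2_compose_Z1 fps2_compose_Z2)

text \<open>\<open>inv\<close> is a definite description, so uniqueness of the two-sided inverse has
  to be shown; it follows from associativity as in any monoid.\<close>

lemma G2_inv_eqI:
  assumes "x \<in> carrier G2" "y \<in> carrier G2"
    and "x \<otimes>\<^bsub>G2\<^esub> y = \<one>\<^bsub>G2\<^esub>" "y \<otimes>\<^bsub>G2\<^esub> x = \<one>\<^bsub>G2\<^esub>"
  shows "inv\<^bsub>G2\<^esub> x = y"
  unfolding m_inv_def
proof (rule the_equality)
  fix z assume z: "z \<in> carrier G2 \<and> x \<otimes>\<^bsub>G2\<^esub> z = \<one>\<^bsub>G2\<^esub> \<and> z \<otimes>\<^bsub>G2\<^esub> x = \<one>\<^bsub>G2\<^esub>"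
  have "z = z \<otimes>\<^bsub>G2\<^esub> (x \<otimes>\<^bsub>G2\<^esub> y)"
    by (simp add: assms(3) G2_r_one)
  also have "\<dots> = z \<otimes>\<^bsub>G2\<^esub> x \<otimes>\<^bsub>G2\<^esub> y"
    using assms(1,2) by (simp add: G2_assoc G2_no_const)
  also have "\<dots> = y"
    using z assms(2) by (simp add: G2_l_one G2_no_const)
  finally show "z = y" .
qed (use assms in simp)

section \<open>Maps that multiply each coordinate by a series in p^k\<close>

definition diag :: "nat \<Rightarrow> complex fps \<Rightarrow> complex fps \<Rightarrow> fps2 \<times> fps2" where
  "diag k a b = (fps2_subst a ((Z1 * Z2) ^ k) * Z1, fps2_subst b ((Z1 * Z2) ^ k) * Z2)"

lemma monomial_0: "k \<ge> 1 \<Longrightarrow> fps2_nth ((Z1 * Z2) ^ k) 0 0 = 0"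
  by (simp add: fps2_nth_Z1)

lemma diag_in_carrier:
  assumes "fps_nth a 0 \<noteq> 0" "fps_nth b 0 \<noteq> 0"
  shows "diag k a b \<in> carrier G2"
  using assms
  by (simp add: G2_def diag_def fps2_nth_Z1 fps2_nth_Z2 linear_part_def invertible_det_nz det_2
      fps2_nth_mult fps2_nth_subst_0)

lemma no_const_diag: "no_const (diag k a b)"
  by (simp add: no_const_def diag_def fps2_nth_Z1 fps2_nth_Z2)

lemma diag_1: "k \<ge> 1 \<Longrightarrow> diag k 1 1 = \<one>\<^bsub>G2\<^esub>"
  by (simp add: diag_def G2_one fps2_subst_1[OF monomial_0])

text \<open>The map \<open>diag k c d\<close> sends x = p^k to \<sigma>(x) with \<sigma> = x (c
  d)^k, again a series in x. Composition of such maps is thus a computation in one variable.\<close>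

lemma diag_mult:
  assumes "k \<ge> 1"
  shows "diag k a b \<otimes>\<^bsub>G2\<^esub> diag k c d =
    diag k ((a oo (fps_X * (c * d) ^ k)) * c) ((b oo (fps_X * (c * d) ^ k)) * d)"
proof -
  let ?x = "(Z1 * Z2) ^ k" and ?D = "diag k c d" and ?\<sigma> = "fps_X * (c * d) ^ k"
  note x = monomial_0[OF assms] and D = no_const_diag[of k c d]
  have "fps2_compose ?x ?D = (fst ?D * snd ?D) ^ k"
    by (simp add: fps2_compose_power fps2_compose_mult fps2_compose_Z1 fps2_compose_Z2 D)
  also have "\<dots> = ?x * (fps2_subst c ?x * fps2_subst d ?x) ^ k"
    by (simp add: diag_def power_mult_distrib ac_simps)
  also have "\<dots> = fps2_subst ?\<sigma> ?x"
    by (simp add: fps2_subst_mult fps2_subst_power fps2_subst_X x del: fps2_nth_power_0)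
  finally have "fps2_compose (fps2_subst u ?x) ?D = fps2_subst (u oo ?\<sigma>) ?x" for u
    by (simp add: fps2_compose_subst[OF x D] fps2_subst_compose[OF x])
  then show ?thesis
    using D by (simp add: G2_mult diag_def[of k a b] fps2_compose_mult fps2_compose_Z1 fps2_compose_Z2)
      (simp add: diag_def fps2_subst_mult[OF x] mult.assoc)
qed

lemma diag_inverse:
  assumes k: "k \<ge> 1" and a: "fps_nth a 0 \<noteq> 0" and b: "fps_nth b 0 \<noteq> 0"
  obtains \<alpha> \<beta> where "diag k \<alpha> \<beta> \<in> carrier G2"
    "diag k a b \<otimes>\<^bsub>G2\<^esub> diag k \<alpha> \<beta> = \<one>\<^bsub>G2\<^esub>" "diag k \<alpha> \<beta> \<otimes>\<^bsub>G2\<^esub> diag k a b = \<one>\<^bsub>G2\<^esub>"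
proof -
  define \<kappa> where "\<kappa> = fps_X * (a * b) ^ k"
  define \<phi> where "\<phi> = fps_inv \<kappa>"
  have \<kappa>0: "fps_nth \<kappa> 0 = 0" and \<kappa>1: "fps_nth \<kappa> 1 \<noteq> 0"
    using a b by (simp_all add: \<kappa>_def fps_power_zeroth)
  have \<phi>0: "fps_nth \<phi> 0 = 0" by (simp add: \<phi>_def fps_inv_def)
  have \<phi>\<kappa>: "\<phi> oo \<kappa> = fps_X" and \<kappa>\<phi>: "\<kappa> oo \<phi> = fps_X"
    unfolding \<phi>_def using \<kappa>0 \<kappa>1 by (rule fps_inv fps_inv_right)+
  \<comment> \<open>If the inverse acts on x by \<phi>, then \<open>diag_mult\<close> forces
    \<alpha> = 1/a(\<phi>) and \<beta> = 1/b(\<phi>). That x (\<alpha> \<beta>)^k is indeed \<phi>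
    follows from \<kappa>(\<phi>) = x.\<close>
  define \<alpha> where "\<alpha> = inverse a oo \<phi>"
  define \<beta> where "\<beta> = inverse b oo \<phi>"
  note dist = fps_compose_mult_distrib[OF \<phi>0]
  have \<alpha>: "(a oo \<phi>) * \<alpha> = 1" and \<beta>: "(b oo \<phi>) * \<beta> = 1"
    using a b by (simp_all add: \<alpha>_def \<beta>_def inverse_mult_eq_1' flip: dist)
  have "fps_X = \<phi> * ((a oo \<phi>) * (b oo \<phi>)) ^ k"
    using \<kappa>\<phi> by (simp add: \<kappa>_def dist fps_X_fps_compose_startby0[OF \<phi>0] flip: fps_compose_power[OF \<phi>0])
  then have "fps_X * (\<alpha> * \<beta>) ^ k = \<phi> * (((a oo \<phi>) * \<alpha>) * ((b oo \<phi>) * \<beta>)) ^ k"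
    by (simp add: power_mult_distrib ac_simps)
  then have \<phi>: "fps_X * (\<alpha> * \<beta>) ^ k = \<phi>"
    by (simp only: \<alpha> \<beta>) simp
  have "\<alpha> oo \<kappa> = inverse a" "\<beta> oo \<kappa> = inverse b"
    by (simp_all add: \<alpha>_def \<beta>_def \<phi>\<kappa> flip: fps_compose_assoc[OF \<kappa>0 \<phi>0])
  then have "diag k \<alpha> \<beta> \<otimes>\<^bsub>G2\<^esub> diag k a b = \<one>\<^bsub>G2\<^esub>"
    using a b by (simp add: diag_mult[OF k] inverse_mult_eq_1 diag_1[OF k] flip: \<kappa>_def)
  moreover have "diag k a b \<otimes>\<^bsub>G2\<^esub> diag k \<alpha> \<beta> = \<one>\<^bsub>G2\<^esub>"
    by (simp add: diag_mult[OF k] \<phi> \<alpha> \<beta> diag_1[OF k])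
  moreover have "diag k \<alpha> \<beta> \<in> carrier G2"
    using a b by (intro diag_in_carrier) (simp_all add: \<alpha>_def \<beta>_def)
  ultimately show ?thesis by (intro that)
qed

lemma conjugate_in_G2_diagI:
  assumes k: "k \<ge> 1" and a: "fps_nth a 0 \<noteq> 0" and b: "fps_nth b 0 \<noteq> 0"
    and F: "F \<in> carrier G2" and G: "G \<in> carrier G2"
    and eq: "diag k a b \<otimes>\<^bsub>G2\<^esub> G = F \<otimes>\<^bsub>G2\<^esub> diag k a b"
  shows "conjugate_in G2 F G"
proof -
  let ?K = "diag k a b"
  obtain \<alpha> \<beta> where H: "diag k \<alpha> \<beta> \<in> carrier G2"
    "?K \<otimes>\<^bsub>G2\<^esub> diag k \<alpha> \<beta> = \<one>\<^bsub>G2\<^esub>" "diag k \<alpha> \<beta> \<otimes>\<^bsub>G2\<^esub> ?K = \<one>\<^bsub>G2\<^esub>"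
    using diag_inverse[OF k a b] by blast
  note nc = no_const_diag G2_no_const[OF F] G2_no_const[OF G]
  \<comment> \<open>The hypothesis gives G = K^(-1) F K, so the conjugating element is
    \<open>diag k \<alpha> \<beta>\<close> and the inverse to be identified is that of this
    element.\<close>
  have inv: "inv\<^bsub>G2\<^esub> (diag k \<alpha> \<beta>) = ?K"
    using H diag_in_carrier[OF a b] by (intro G2_inv_eqI)
  have "diag k \<alpha> \<beta> \<otimes>\<^bsub>G2\<^esub> F \<otimes>\<^bsub>G2\<^esub> ?K = diag k \<alpha> \<beta> \<otimes>\<^bsub>G2\<^esub> (?K \<otimes>\<^bsub>G2\<^esub> G)"
    by (simp add: G2_assoc nc eq)
  also have "\<dots> = G"
    by (simp add: H(3) nc G2_l_one flip: G2_assoc)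
  finally show ?thesis
    unfolding conjugate_in_def using F G H(1) inv by metis
qed

theorem proposition1p4:
  fixes lam :: complex and k :: nat and p :: fps2
  assumes "lam \<noteq> 0"
    and "\<And>n::nat. n \<ge> 1 \<Longrightarrow> lam ^ n \<noteq> 1"
    and "k \<ge> 1"
    and "p = Z1 * Z2"
  shows "conjugate_in G2
    (fps2_subst (fps_const lam * fps_root1 k (1 + fps_X) / fps_root1 k (1 + 2 * fps_X)) (p ^ k) * Z1,
     fps2_subst (1 / (fps_const lam * fps_root1 k (1 + fps_X))) (p ^ k) * Z2)
    (fps2_const lam * (1 + p ^ k) * Z1,
     fps2_const (inverse lam) * (1 + p ^ k + of_nat (2 * k + 1) * p ^ (2 * k)) * Z2)"
proof -
  note lam = assms(1) and k = assms(3) and p = assms(4)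
  have root: "fps_nth (fps_root1 k u) 0 = 1 \<and> fps_root1 k u ^ k = u" if "fps_nth u 0 = 1" for u
    using theI'[OF fps_root1_unique_exists[OF k that]] unfolding fps_root1_def .
  define r\<^sub>1 where "r\<^sub>1 = fps_root1 k (1 + fps_X)"
  define r\<^sub>2 where "r\<^sub>2 = fps_root1 k (1 + 2 * fps_X)"
  have r\<^sub>1: "fps_nth r\<^sub>1 0 = 1" "r\<^sub>1 ^ k = 1 + fps_X"
    and r\<^sub>2: "fps_nth r\<^sub>2 0 = 1" "r\<^sub>2 ^ k = 1 + 2 * fps_X"
    unfolding r\<^sub>1_def r\<^sub>2_def using root[of "1 + fps_X"] root[of "1 + 2 * fps_X"] by simp_all
  define Q :: "complex fps" where "Q = 1 + fps_X + of_nat (2 * k + 1) * fps_X ^ 2"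
  define \<gamma> where "\<gamma> = fps_X * ((1 + fps_X) * Q) ^ k"
  obtain a b where ab: "fps_nth a 0 \<noteq> 0" "fps_nth b 0 \<noteq> 0"
    "(a oo \<gamma>) * (1 + fps_X) = ((r\<^sub>1 / r\<^sub>2) oo (fps_X * (a * b) ^ k)) * a"
    "(b oo \<gamma>) * Q = ((1 / r\<^sub>1) oo (fps_X * (a * b) ^ k)) * b"
    using one_variable_conjugacy[OF k r\<^sub>1 r\<^sub>2] unfolding \<gamma>_def Q_def by blast
  define \<kappa> where "\<kappa> = fps_X * (a * b) ^ k"
  have \<kappa>0: "fps_nth \<kappa> 0 = 0" by (simp add: \<kappa>_def)
  let ?F = "diag k (fps_const lam * (r\<^sub>1 / r\<^sub>2)) (fps_const (inverse lam) * (1 / r\<^sub>1))"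
  let ?G = "diag k (fps_const lam * (1 + fps_X)) (fps_const (inverse lam) * Q)"
  have F: "(fps2_subst (fps_const lam * r\<^sub>1 / r\<^sub>2) (p ^ k) * Z1,
      fps2_subst (1 / (fps_const lam * r\<^sub>1)) (p ^ k) * Z2) = ?F"
    using r\<^sub>1 r\<^sub>2 lam
    by (simp add: diag_def p fps_divide_unit mult.assoc fps_inverse_mult fps_const_inverse)
  note x = monomial_0[OF k]
  have of_nat: "fps2_subst (of_nat n) ((Z1 * Z2) ^ k) = of_nat n" for n
    by (induction n) (simp_all add: fps2_subst_add[OF x] fps2_subst_1[OF x] fps2_subst_const[OF x, of 0, simplified] fps2_const_def)
  have G: "(fps2_const lam * (1 + p ^ k) * Z1,
      fps2_const (inverse lam) * (1 + p ^ k + of_nat (2 * k + 1) * p ^ (2 * k)) * Z2) = ?G"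
    unfolding diag_def Q_def p fps2_subst_mult[OF x] fps2_subst_add[OF x] fps2_subst_1[OF x]
      fps2_subst_power[OF x] fps2_subst_X[OF x] fps2_subst_const[OF x] of_nat
    by (simp only: power_mult mult.commute[of 2 k])
  \<comment> \<open>The factors \<lambda> and 1/\<lambda> cancel in the action on p^k, so this
    action is the \<gamma> of the one-variable equations.\<close>
  have lam_prod: "fps_const lam * A * (fps_const (inverse lam) * B) = A * B" for A B :: "complex fps"
  proof -
    have "fps_const lam * A * (fps_const (inverse lam) * B) = fps_const (lam * inverse lam) * (A * B)"
      unfolding fps_const_mult[symmetric] by (simp only: ac_simps)
    then show ?thesis using lam by simp
  qed
  have "conjugate_in G2 ?F ?G"
  proof (rule conjugate_in_G2_diagI[OF k ab(1,2)])
    show "?F \<in> carrier G2" "?G \<in> carrier G2"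
      using lam r\<^sub>1 r\<^sub>2 by (auto intro!: diag_in_carrier simp: fps_divide_unit Q_def)
    show "diag k a b \<otimes>\<^bsub>G2\<^esub> ?G = ?F \<otimes>\<^bsub>G2\<^esub> diag k a b"
      unfolding diag_mult[OF k] lam_prod \<gamma>_def[symmetric] \<kappa>_def[symmetric]
        fps_compose_mult_distrib[OF \<kappa>0] fps_const_compose
      by (simp only: mult.assoc mult.left_commute[of _ "fps_const c" for c] ab(3,4) flip: \<kappa>_def)
  qed
  then show ?thesis
    by (simp only: F G flip: r\<^sub>1_def r\<^sub>2_def)
qed

end
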